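(* There are at least seventeen completely dissociative groupoids $\langle 3;\diamond\rangle$ on the set $3=\{0,1,2\}$; that is, at least seventeen distinct binary operations $\diamond:3\times 3\to 3$ for which $\langle 3;\diamond\rangle$ is completely dissociative.
   Context: Groupoids on $3=\{0,1,2\}$ are counted as binary operation tables (distinct operations are counted as distinct, without identifying isomorphic ones). A groupoid $\langle G;\diamond\rangle$ is a set $G$ with a binary operation $\diamond$ on $G$. $\mathbf{N}=\{1,2,3,\ldots\}$, and $G^\omega$ is the set of infinite sequences $\vec g=g_0g_1g_2\ldots$ of elements of $G$. For $k\in\mathbf{N}$, $F^\sigma(k)$ is the set of formal $k$-products: the finite words $\mathbf{u}$ over the alphabet $\{\bullet,x_0,x_1,x_2,\ldots\}$ such that (1) $x_0x_1\ldots x_{k-1}$ is a subsequence of $\mathbf{u}$; (2) $\mathbf{u}$ has length $2k-1$; (3) $\bullet$ occurs exactly $k-1$ times in $\mathbf{u}$; (4) in every nonempty prefix of $\mathbf{u}$ the number of occurrences of $\bullet$ is strictly less than the number of other letters. These are exactly the reverse Polish forms of the full parenthesizations of $x_0x_1\ldots x_{k-1}$ (each variable once, in this order). For $\mathbf{u}\in F^\sigma(k)$ and $\vec g\in G^\omega$, $\vec g\,\mathbf{u}^\diamond\in G$ is the element obtained by replacing each $x_i$ in $\mathbf{u}$ by $g_i$ and each $\bullet$ by $\diamond$ and evaluating in reverse Polish notation ($ab\diamond$ means $a\diamond b$). $\langle G;\diamond\rangle$ is $k$-dissociative iff for every pair $\mathbf{u}\neq\mathbf{v}$ in $F^\sigma(k)$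 there is $\vec g\in G^\omega$ with $\vec g\,\mathbf{u}^\diamond\neq\vec g\,\mathbf{v}^\diamond$. It is completely dissociative iff it is $k$-dissociative for every $k\ge 3$. *)

theory Defs
  imports Main "HOL-Library.Sublist" "HOL-Library.Numeral_Type"
begin

text \<open>A groupoid is given by a type \<open>'a\<close> (the set \<open>G\<close>) and a binary operation on it.\<close>

datatype letter = Bullet | X nat

text \<open>
  The set \<open>F\<^sup>\<sigma>(k)\<close> of formal \<open>k\<close>-products, for \<open>k \<ge> 1\<close>.  For \<open>k = 0\<close> the truncated
  subtractions make the set meaningless; that case is never used.
\<close>

definition formal_products :: "nat \<Rightarrow> letter list set" where
  "formal_products k = {u.
     subseq (map X [0..<k]) u \<and>
     length u = 2 * k - 1 \<and>
     count_list u Bullet = k - 1 \<and>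
     (\<forall>p. prefix p u \<and> p \<noteq> [] \<longrightarrow>
        count_list p Bullet < length (filter (\<lambda>c. c \<noteq> Bullet) p))}"

text \<open>
  Reverse Polish evaluation on a stack whose head is its top, so \<open>b\<close> is the right operand.
  The last equation is a stack underflow, which the prefix condition on formal products excludes.
\<close>

fun rpn :: "('a \<Rightarrow> 'a \<Rightarrow> 'a) \<Rightarrow> (nat \<Rightarrow> 'a) \<Rightarrow> letter list \<Rightarrow> 'a list \<Rightarrow> 'a list" where
  "rpn d g [] st = st"
| "rpn d g (X i # w) st = rpn d g w (g i # st)"
| "rpn d g (Bullet # w) (b # a # st) = rpn d g w (d a b # st)"
| "rpn d g (Bullet # w) st = undefined"

definition rpn_value :: "('a \<Rightarrow> 'a \<Rightarrow> 'a) \<Rightarrow> (nat \<Rightarrow> 'a) \<Rightarrow> letter list \<Rightarrow> 'a" where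
  "rpn_value d g u = hd (rpn d g u [])"

definition dissociative :: "nat \<Rightarrow> ('a \<Rightarrow> 'a \<Rightarrow> 'a) \<Rightarrow> bool" where
  "dissociative k d \<longleftrightarrow>
     (\<forall>u \<in> formal_products k. \<forall>v \<in> formal_products k.
        u \<noteq> v \<longrightarrow> (\<exists>g :: nat \<Rightarrow> 'a. rpn_value d g u \<noteq> rpn_value d g v))"

definition completely_dissociative :: "('a \<Rightarrow> 'a \<Rightarrow> 'a) \<Rightarrow> bool" where
  "completely_dissociative d \<longleftrightarrow> (\<forall>k \<ge> 3. dissociative k d)"

end

theory Submission
  imports Defs
begin

text \<open>
  Boolean implication is completely dissociative, and complete dissociativity passes from a
  groupoid to every groupoid that contains a copy of it, because the assignments that separate two
  products may be taken inside the copy.  An operation on \<open>3\<close> that restricts to implication on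
  \<open>{0, 1}\<close> is therefore completely dissociative however it treats the element \<open>2\<close>; leaving only the
  row of \<open>2\<close> free already gives \<open>3\<^sup>3 = 27\<close> tables.

  Implication separates two different full parenthesizations (binary trees) \<open>s = s1 \<longrightarrow> s2\<close> and
  \<open>t = t1 \<longrightarrow> t2\<close> of the same variables, in a way that depends on where they split.  If both trees split the variables at the
  same place, then a difference between \<open>s1\<close> and \<open>t1\<close> becomes visible when \<open>s2\<close> and \<open>t2\<close> are made
  false, and a difference between \<open>s2\<close> and \<open>t2\<close> when \<open>s1\<close> and \<open>t1\<close> are made true.  If \<open>s\<close> splits
  earlier, make \<open>s1\<close> false, which makes \<open>s\<close> true; the last variable of \<open>t1\<close> does not occur in \<open>s1\<close>
  and can still be set to true, which makes \<open>t1\<close> true; making \<open>t2\<close> false then makes \<open>t\<close> false.  All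
  of these choices are possible because a tree is true as soon as its last variable is, and false
  when its last variable is the only false one.
\<close>

section \<open>Formal products as binary trees\<close>

datatype tree = Leaf nat | Node tree tree

primrec leaves :: "tree \<Rightarrow> nat list" where
  "leaves (Leaf i) = [i]"
| "leaves (Node l r) = leaves l @ leaves r"

primrec postfix :: "tree \<Rightarrow> letter list" where
  "postfix (Leaf i) = [X i]"
| "postfix (Node l r) = postfix l @ postfix r @ [Bullet]"

primrec tree_value :: "('a \<Rightarrow> 'a \<Rightarrow> 'a) \<Rightarrow> (nat \<Rightarrow> 'a) \<Rightarrow> tree \<Rightarrow> 'a" where
  "tree_value d g (Leaf i) = g i"
| "tree_value d g (Node l r) = d (tree_value d g l) (tree_value d g r)"

lemma leaves_nonempty [simp]: "leaves t \<noteq> []"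
  by (induction t) auto

lemma rpn_postfix: "rpn d g (postfix t @ w) st = rpn d g w (tree_value d g t # st)"
  by (induction t arbitrary: w st) auto

lemma rpn_value_postfix: "rpn_value d g (postfix t) = tree_value d g t"
  using rpn_postfix[of d g t "[]" "[]"] by (simp add: rpn_value_def)

lemma filter_postfix: "filter (\<lambda>c. c \<noteq> Bullet) (postfix t) = map X (leaves t)"
  by (induction t) auto

lemma tree_value_cong:
  "(\<And>i. i \<in> set (leaves t) \<Longrightarrow> g i = h i) \<Longrightarrow> tree_value d g t = tree_value d h t"
  by (induction t) auto

text \<open>
  Reading a word from left to right keeps a stack of parsed trees, whose height is the excess of
  variables over bullets.  The prefix condition says that a bullet always finds two trees to join.
\<close>

lemma parse_forest:
  assumes "\<And>p. prefix p w \<Longrightarrow> p \<noteq> [] \<Longrightarrow>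
             count_list p Bullet < length (filter (\<lambda>c. c \<noteq> Bullet) p)"
  shows "\<exists>ts. w = concat (map postfix ts) \<and>
           length (filter (\<lambda>c. c \<noteq> Bullet) w) = count_list w Bullet + length ts"
  using assms
proof (induction w rule: rev_induct)
  case Nil
  show ?case by (rule exI[of _ "[]"]) simp
next
  case (snoc c w)
  have "\<And>p. prefix p w \<Longrightarrow> prefix p (w @ [c])"
    by simp
  then obtain ts where w: "w = concat (map postfix ts)"
    and height: "length (filter (\<lambda>c. c \<noteq> Bullet) w) = count_list w Bullet + length ts"
    using snoc.IH snoc.prems by blast
  show ?case
  proof (cases c)
    case (X i)
    with w height show ?thesis
      by (intro exI[of _ "ts @ [Leaf i]"]) simp
  next
    case Bullet
    have "count_list (w @ [c]) Bullet < length (filter (\<lambda>c. c \<noteq> Bullet) (w @ [c]))"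
      using snoc.prems by blast
    with height Bullet have "2 \<le> length (rev ts)"
      by simp
    then obtain l r us where "rev ts = r # l # us"
      unfolding numeral_2_eq_2 Suc_le_length_iff by blast
    then have "ts = rev us @ [l, r]"
      by (simp add: rev_eq_Cons_iff)
    with w height Bullet show ?thesis
      by (intro exI[of _ "rev us @ [Node l r]"]) simp
  qed
qed

lemma formal_product_is_postfix:
  assumes "u \<in> formal_products k" and "1 \<le> k"
  obtains t where "u = postfix t" and "leaves t = [0..<k]"
proof -
  let ?vars = "filter (\<lambda>c. c \<noteq> Bullet)"
  have sub: "subseq (map X [0..<k]) u" and len: "length u = 2 * k - 1"
    and bullets: "count_list u Bullet = k - 1"
    and pre: "\<And>p. prefix p u \<Longrightarrow> p \<noteq> [] \<Longrightarrow> count_list p Bullet < length (?vars p)"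
    using assms(1) by (auto simp: formal_products_def)
  have "length u = count_list u Bullet + length (?vars u)"
    by (induction u) auto
  with len bullets \<open>1 \<le> k\<close> have n_vars: "length (?vars u) = k"
    by simp
  have "subseq (?vars (map X [0..<k])) (?vars u)"
    using sub by (rule subseq_filter)
  moreover have "?vars (map X [0..<k]) = map X [0..<k]"
    by (simp add: filter_id_conv)
  ultimately have vars: "?vars u = map X [0..<k]"
    using subseq_same_length[of "map X [0..<k]" "?vars u"] n_vars by simp
  obtain ts where ts: "u = concat (map postfix ts)"
    and height: "length (?vars u) = count_list u Bullet + length ts"
    using parse_forest[OF pre] by blast
  have "length ts = Suc 0"
    using height n_vars bullets \<open>1 \<le> k\<close> by simp
  then obtain t where "ts = [t]"
    by (auto simp: length_Suc_conv)
  with ts have t: "u = postfix t"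
    by simp
  moreover have "inj X"
    by (simp add: inj_def)
  then have "leaves t = [0..<k]"
    using vars filter_postfix[of t] t by (metis inj_map_eq_map)
  ultimately show thesis
    by (rule that)
qed

section \<open>Implication separates parenthesizations\<close>

lemma imp_tree_true:
  "g (last (leaves t)) \<Longrightarrow> tree_value (\<longrightarrow>) g t"
  by (induction t) auto

text \<open>
  The left factors of the right spine are true because they end in a true variable.  Distinctness
  guarantees that the last variable does not reappear in them.
\<close>

lemma imp_tree_false:
  assumes "distinct (leaves t)"
    and "\<And>i. i \<in> set (leaves t) \<Longrightarrow> g i \<longleftrightarrow> i \<noteq> last (leaves t)"
  shows "\<not> tree_value (\<longrightarrow>) g t"
  using assms
proof (induction t)
  case (Node l r)
  have "last (leaves l) \<noteq> last (leaves r)"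
    using Node.prems(1) by (metis distinct_append disjoint_iff last_in_set leaves.simps(2) leaves_nonempty)
  with Node.prems(2)[of "last (leaves l)"] have "g (last (leaves l))"
    by simp
  then have "tree_value (\<longrightarrow>) g l"
    by (rule imp_tree_true)
  moreover have "\<not> tree_value (\<longrightarrow>) g r"
    using Node by simp
  ultimately show ?case
    by simp
qed simp

lemma imp_separates_unequal_splits:
  assumes "distinct (leaves s1 @ leaves s2)"
    and t1: "leaves t1 = leaves s1 @ us" and "us \<noteq> []" and s2: "leaves s2 = us @ leaves t2"
  shows "\<exists>g. tree_value (\<longrightarrow>) g (Node s1 s2) \<noteq> tree_value (\<longrightarrow>) g (Node t1 t2)"
proof -
  let ?x = "last (leaves s1)" and ?y = "last us" and ?z = "last (leaves t2)"
  define g where "g i \<longleftrightarrow> i \<noteq> ?x \<and> i \<noteq> ?z" for i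
  have in_sets: "?x \<in> set (leaves s1)" "?y \<in> set us" "?z \<in> set (leaves t2)"
    using \<open>us \<noteq> []\<close> by simp_all
  then have disj: "?x \<notin> set us" "?x \<notin> set (leaves t2)" "?y \<noteq> ?x" "?y \<noteq> ?z" "?z \<notin> set (leaves s1)"
    using assms(1) s2 by (auto simp: disjoint_iff)
  have "\<not> tree_value (\<longrightarrow>) g s1"
    by (rule imp_tree_false) (use assms in_sets disj in \<open>auto simp: g_def\<close>)
  moreover have "\<not> tree_value (\<longrightarrow>) g t2"
    by (rule imp_tree_false) (use assms in_sets disj in \<open>auto simp: g_def\<close>)
  moreover have "tree_value (\<longrightarrow>) g t1"
    by (rule imp_tree_true) (use assms in_sets disj in \<open>auto simp: g_def\<close>)
  ultimately show ?thesis
    by auto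
qed

lemma imp_separates_trees:
  assumes "leaves s = leaves t" and "distinct (leaves s)" and "s \<noteq> t"
  shows "\<exists>g. tree_value (\<longrightarrow>) g s \<noteq> tree_value (\<longrightarrow>) g t"
  using assms
proof (induction s arbitrary: t)
  case (Leaf i)
  then show ?case
    by (cases t) (auto simp: Cons_eq_append_conv)
next
  case (Node s1 s2)
  obtain t1 t2 where t: "t = Node t1 t2"
    using Node.prems(1) by (cases t) (auto simp: append_eq_Cons_conv)
  have split: "leaves s1 @ leaves s2 = leaves t1 @ leaves t2"
    using Node.prems(1) t by simp
  have dist: "distinct (leaves s1 @ leaves s2)" "distinct (leaves t1 @ leaves t2)"
    using Node.prems(2) split by simp_all
  consider (same) "leaves s1 = leaves t1" "leaves s2 = leaves t2"
    | (s_earlier) us where "us \<noteq> []" "leaves t1 = leaves s1 @ us" "leaves s2 = us @ leaves t2"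
    | (t_earlier) us where "us \<noteq> []" "leaves s1 = leaves t1 @ us" "leaves t2 = us @ leaves s2"
    using split by (fastforce simp: append_eq_append_conv2)
  then show ?case
  proof cases
    case same
    show ?thesis
    proof (cases "s1 = t1")
      case False
      with Node.IH(1) same dist obtain g
        where g: "tree_value (\<longrightarrow>) g s1 \<noteq> tree_value (\<longrightarrow>) g t1"
        by auto
      define h where
        "h i \<longleftrightarrow> (if i \<in> set (leaves s1) then g i else i \<noteq> last (leaves s2))" for i
      have "tree_value (\<longrightarrow>) h s1 = tree_value (\<longrightarrow>) g s1"
        by (rule tree_value_cong) (simp add: h_def)
      moreover have "tree_value (\<longrightarrow>) h t1 = tree_value (\<longrightarrow>) g t1"
        by (rule tree_value_cong) (simp add: h_def same)
      moreover have "\<not> tree_value (\<longrightarrow>) h s2"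
        by (rule imp_tree_false) (use dist in \<open>auto simp: h_def\<close>)
      moreover have "\<not> tree_value (\<longrightarrow>) h t2"
        by (rule imp_tree_false) (use dist same in \<open>auto simp: h_def\<close>)
      ultimately show ?thesis
        using g t by auto
    next
      case True
      with Node.prems t have "s2 \<noteq> t2"
        by simp
      with Node.IH(2) same dist obtain g
        where g: "tree_value (\<longrightarrow>) g s2 \<noteq> tree_value (\<longrightarrow>) g t2"
        by auto
      define h where "h i \<longleftrightarrow> i \<in> set (leaves s1) \<or> g i" for i
      have "tree_value (\<longrightarrow>) h s2 = tree_value (\<longrightarrow>) g s2"
        by (rule tree_value_cong) (use dist in \<open>auto simp: h_def\<close>)
      moreover have "tree_value (\<longrightarrow>) h t2 = tree_value (\<longrightarrow>) g t2"
        by (rule tree_value_cong) (use dist same in \<open>auto simp: h_def\<close>)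
      moreover have "tree_value (\<longrightarrow>) h s1"
        by (rule imp_tree_true) (simp add: h_def)
      ultimately show ?thesis
        using g t True by auto
    qed
  next
    case s_earlier
    with dist(1) t show ?thesis
      using imp_separates_unequal_splits by blast
  next
    case t_earlier
    with dist(2) t show ?thesis
      using imp_separates_unequal_splits[of t1 t2 s1 us s2] by metis
  qed
qed

section \<open>Groupoids that contain implication\<close>

lemma tree_value_hom:
  assumes "\<And>x y. h (e x y) = d (h x) (h y)"
  shows "tree_value d (h \<circ> g) t = h (tree_value e g t)"
  by (induction t) (simp_all add: assms)

lemma completely_dissociative_if_contains_imp:
  fixes h :: "bool \<Rightarrow> 'a"
  assumes "inj h" and hom: "\<And>x y. h (x \<longrightarrow> y) = d (h x) (h y)"
  shows "completely_dissociative d"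
  unfolding completely_dissociative_def dissociative_def
proof (intro allI impI ballI)
  fix k u v
  assume "3 \<le> k" and uv: "u \<in> formal_products k" "v \<in> formal_products k" "u \<noteq> v"
  then have "1 \<le> k"
    by simp
  obtain s where s: "u = postfix s" "leaves s = [0..<k]"
    using formal_product_is_postfix[OF uv(1) \<open>1 \<le> k\<close>] .
  obtain t where t: "v = postfix t" "leaves t = [0..<k]"
    using formal_product_is_postfix[OF uv(2) \<open>1 \<le> k\<close>] .
  have "s \<noteq> t"
    using s t uv(3) by auto
  then obtain g where "tree_value (\<longrightarrow>) g s \<noteq> tree_value (\<longrightarrow>) g t"
    using imp_separates_trees[of s t] s t by auto
  then have "rpn_value d (h \<circ> g) u \<noteq> rpn_value d (h \<circ> g) v"
    using \<open>inj h\<close> by (simp add: s t rpn_value_postfix tree_value_hom[of h "(\<longrightarrow>)" d, OF hom] inj_eq)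
  then show "\<exists>g. rpn_value d g u \<noteq> rpn_value d g v"
    by blast
qed

theorem theorem3p8:
  "17 \<le> card {d :: 3 \<Rightarrow> 3 \<Rightarrow> 3. completely_dissociative d}"
proof -
  \<comment> \<open>Rows \<open>0\<close> and \<open>1\<close> are chosen so that \<open>{0, 1}\<close> carries implication with \<open>0\<close> as false; the
    row of \<open>2\<close> is the arbitrary function \<open>p\<close>.\<close>
  define D :: "(3 \<Rightarrow> 3) \<Rightarrow> 3 \<Rightarrow> 3 \<Rightarrow> 3" where
    "D p x y = (if x = 0 then 1 else if x = 1 then y else p y)" for p x y
  have "completely_dissociative (D p)" for p
    by (rule completely_dissociative_if_contains_imp[of of_bool]) (auto simp: D_def inj_def)
  then have "range D \<subseteq> {d. completely_dissociative d}"
    by auto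
  then have "card (range D) \<le> card {d :: 3 \<Rightarrow> 3 \<Rightarrow> 3. completely_dissociative d}"
    by (intro card_mono) auto
  moreover have "inj D"
  proof (rule injI)
    fix p q
    assume "D p = D q"
    then have "D p 2 y = D q 2 y" for y
      by simp
    then show "p = q"
      by (auto simp: D_def fun_eq_iff)
  qed
  then have "card (range D) = 27"
    by (simp add: card_image card_fun)
  ultimately show ?thesis
    by simp
qed

end
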